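(* Let $\mathbf{N}=(V,H,s,t)$ be a hypernetwork of order $k$, with fixed internal phase spaces $\mathbb{R}^{n_v}$ ($v\in V$, $n_v\ge 1$) such that $n_{v_1}=n_{v_2}$ whenever $v_1,v_2$ have the same vertex-type. Let $P=\{V_1,\ldots,V_C\}$ be a partition of $V$ that refines the partition into vertex-types, and define $$\mathrm{Syn}_P:=\Big\{x\in\bigoplus_{v\in V}\mathbb{R}^{n_v} \;:\; x_{v_1}=x_{v_2}\ \text{whenever } v_1,v_2 \text{ are in the same element of } P\Big\}.$$ The following are equivalent: (i) The partition $P$ is balanced. (ii) $\mathrm{Syn}_P$ is invariant under any $\mathbf{N}$-admissible map, i.e., it is robust. (iii) $\mathrm{Syn}_P$ is invariant under any polynomial $\mathbf{N}$-admissible map of degree at most $\frac{k(k+1)}{2}$.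
   Context: **Hypernetwork.** A hypernetwork is a tuple $\mathbf{N}=(V,H,s,t)$ with $V$ a finite set of vertices and $H$ a finite set of hyperedges. The map $s$ assigns to each hyperedge $h$ a finite ordered list of source vertices $s(h)=(s_1(h),\ldots,s_k(h))\in V^k$ (repetitions allowed); the length $k$ is the order of $h$, and the order of the hypernetwork is the maximum of the orders of its hyperedges. The map $t:H\to V$ assigns to each hyperedge a unique target vertex. All vertices and hyperedges are assigned a type (from some finite set) such that: (1) if $h_1,h_2\in H$ have the same type, then they have equal order $k$, $s_i(h_1)$ and $s_i(h_2)$ have the same type for each $i=1,\ldots,k$, and $t(h_1)$ and $t(h_2)$ have the same type; (2) if $v_1,v_2\in V$ have the same type, then there is a type-preserving bijection $\alpha:t^{-1}(v_1)\to t^{-1}(v_2)$ between the hyperedges that target $v_1$ and $v_2$. **Admissible maps.** For $x=\bigoplus_{v\in V}x_v\in\bigoplus_{v\in V}\mathbb{R}^{n_v}$ and a hyperedge $h$ of order $k$ write $\mathbf{x}_{s(h)}=(x_{s_1(h)},\ldots,x_{s_k(h)})$. A map (vector field) $f:\bigoplus_{v\in V}\mathbb{R}^{n_v}\to\bigoplus_{v\in V}\mathbb{R}^{n_v}$ is $\mathbf{N}$-admissible if it has the form $$f_v(x)=F_v\Big(\bigoplus_{h:\,t(h)=v}\mathbf{x}_{s(h)}\Big)$$ for response functions $F_v:\bigoplus_{h:\,t(h)=v}(\mathbb{R}^{n_{s_1(h)}}\oplus\cdots\oplus\mathbb{R}^{n_{s_k(h)}})\to\mathbb{R}^{n_v}$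 (arguments indexed by the hyperedges targeting $v$) such that, for any two vertices $v_1,v_2$ of the same type (possibly equal) and any hyperedge-type-preserving bijection $\alpha:t^{-1}(v_1)\to t^{-1}(v_2)$, $$F_{v_2}\Big(\bigoplus_{t(h_2)=v_2}\mathbf{X}_{h_2}\Big)=F_{v_1}\Big(\bigoplus_{t(h_1)=v_1}\mathbf{X}_{\alpha(h_1)}\Big)$$ as an identity in the inputs $\mathbf{X}_{h_2}$ (in particular with $\mathbf{X}_{h}=\mathbf{x}_{s(h)}$). **Invariance.** A subspace $W$ is invariant under a map $f$ if $f(W)\subset W$. **Balanced partition.** A partition $P=\{V_1,\ldots,V_C\}$ of $V$ is balanced if for all $v_1,v_2$ in the same element of $P$: (1) $v_1$ and $v_2$ have the same vertex-type; (2) there is a hyperedge-type-preserving bijection $\alpha:t^{-1}(v_1)\to t^{-1}(v_2)$ such that for every $h_1\in t^{-1}(v_1)$ of order $k$ and every $1\le i\le k$, the sources $s_i(h_1)$ and $s_i(\alpha(h_1))$ are in the same element of $P$. *)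

theory Defs
  imports "Jordan_Normal_Form.Matrix" "HOL-Library.FuncSet" "HOL-Library.Disjoint_Sets"
begin

record ('v, 'h, 'a, 'b) hypernet =
  verts :: "'v set"
  edges :: "'h set"
  src :: "'h \<Rightarrow> 'v list"
  tgt :: "'h \<Rightarrow> 'v"
  vtype :: "'v \<Rightarrow> 'a"
  htype :: "'h \<Rightarrow> 'b"

definition in_edges :: "('v, 'h, 'a, 'b) hypernet \<Rightarrow> 'v \<Rightarrow> 'h set" where
  "in_edges N v = {h \<in> edges N. tgt N h = v}"

definition type_bij ::
    "('v, 'h, 'a, 'b) hypernet \<Rightarrow> 'v \<Rightarrow> 'v \<Rightarrow> ('h \<Rightarrow> 'h) \<Rightarrow> bool" where
  "type_bij N v1 v2 \<alpha> \<longleftrightarrow>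
     bij_betw \<alpha> (in_edges N v1) (in_edges N v2) \<and>
     (\<forall>h \<in> in_edges N v1. htype N (\<alpha> h) = htype N h)"

text \<open>Only finitely many types occur on the finite vertex and hyperedge sets, so the type labels
  may come from arbitrary Isabelle types.\<close>

locale hypernetwork =
  fixes N :: "('v, 'h, 'a, 'b) hypernet"
  assumes finite_verts: "finite (verts N)"
    and finite_edges: "finite (edges N)"
    and src_verts: "h \<in> edges N \<Longrightarrow> set (src N h) \<subseteq> verts N"
    and tgt_verts: "h \<in> edges N \<Longrightarrow> tgt N h \<in> verts N"
    and htype_order: "\<lbrakk>h1 \<in> edges N; h2 \<in> edges N; htype N h1 = htype N h2\<rbrakk>
          \<Longrightarrow> length (src N h1) = length (src N h2)"
    and htype_src: "\<lbrakk>h1 \<in> edges N; h2 \<in> edges N; htype N h1 = htype N h2; i < length (src N h1)\<rbrakk>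
          \<Longrightarrow> vtype N (src N h1 ! i) = vtype N (src N h2 ! i)"
    and htype_tgt: "\<lbrakk>h1 \<in> edges N; h2 \<in> edges N; htype N h1 = htype N h2\<rbrakk>
          \<Longrightarrow> vtype N (tgt N h1) = vtype N (tgt N h2)"
    and vtype_in_edges: "\<lbrakk>v1 \<in> verts N; v2 \<in> verts N; vtype N v1 = vtype N v2\<rbrakk>
          \<Longrightarrow> \<exists>\<alpha>. type_bij N v1 v2 \<alpha>"

text \<open>The inserted \<open>0\<close> only matters for a hypernetwork without hyperedges.\<close>

definition hypernet_order :: "('v, 'h, 'a, 'b) hypernet \<Rightarrow> nat" where
  "hypernet_order N = Max (insert 0 ((\<lambda>h. length (src N h)) ` edges N))"

definition vtype_partition :: "('v, 'h, 'a, 'b) hypernet \<Rightarrow> 'v set set" where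
  "vtype_partition N = (\<lambda>v. {u \<in> verts N. vtype N u = vtype N v}) ` verts N"

text \<open>Throughout, \<open>n v\<close> is the dimension of the internal phase space at the vertex \<open>v\<close>.\<close>

definition phase_space ::
    "('v, 'h, 'a, 'b) hypernet \<Rightarrow> ('v \<Rightarrow> nat) \<Rightarrow> ('v \<Rightarrow> real vec) set" where
  "phase_space N n = (\<Pi>\<^sub>E v \<in> verts N. carrier_vec (n v))"

text \<open>The domain of a response function at \<open>v\<close>: one list of state vectors, of the dimensions
  prescribed by the source list, for each hyperedge targeting \<open>v\<close>.\<close>

definition input_space ::
    "('v, 'h, 'a, 'b) hypernet \<Rightarrow> ('v \<Rightarrow> nat) \<Rightarrow> 'v \<Rightarrow> ('h \<Rightarrow> real vec list) set" where
  "input_space N n v =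
     (\<Pi>\<^sub>E h \<in> in_edges N v. {ys. list_all2 (\<lambda>y u. y \<in> carrier_vec (n u)) ys (src N h)})"

definition response_family ::
    "('v, 'h, 'a, 'b) hypernet \<Rightarrow> ('v \<Rightarrow> nat) \<Rightarrow> ('v \<Rightarrow> ('h \<Rightarrow> real vec list) \<Rightarrow> real vec) \<Rightarrow> bool"
  where
  "response_family N n F \<longleftrightarrow>
     (\<forall>v \<in> verts N. F v \<in> input_space N n v \<rightarrow> carrier_vec (n v)) \<and>
     (\<forall>v1 \<in> verts N. \<forall>v2 \<in> verts N. \<forall>\<alpha>.
        vtype N v1 = vtype N v2 \<longrightarrow> type_bij N v1 v2 \<alpha> \<longrightarrow>
        (\<forall>X \<in> input_space N n v2. F v2 X = F v1 (\<lambda>h \<in> in_edges N v1. X (\<alpha> h))))"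

definition admissible ::
    "('v, 'h, 'a, 'b) hypernet \<Rightarrow> ('v \<Rightarrow> nat) \<Rightarrow> (('v \<Rightarrow> real vec) \<Rightarrow> ('v \<Rightarrow> real vec)) \<Rightarrow> bool"
  where
  "admissible N n f \<longleftrightarrow>
     f \<in> phase_space N n \<rightarrow> phase_space N n \<and>
     (\<exists>F. response_family N n F \<and>
        (\<forall>x \<in> phase_space N n. \<forall>v \<in> verts N.
           f x v = F v (\<lambda>h \<in> in_edges N v. map x (src N h))))"

definition coords :: "('v, 'h, 'a, 'b) hypernet \<Rightarrow> ('v \<Rightarrow> nat) \<Rightarrow> ('v \<times> nat) set" where
  "coords N n = (SIGMA v : verts N. {..<n v})"

text \<open>\<open>E\<close> is a finite set of exponent vectors \<open>e\<close>, each encoding the monomial that is the product of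
  \<open>(x v $ i) ^ e (v, i)\<close> over all coordinates \<open>(v, i)\<close>; \<open>c\<close> gives the coefficients.\<close>

definition poly_fun_le ::
    "('v, 'h, 'a, 'b) hypernet \<Rightarrow> ('v \<Rightarrow> nat) \<Rightarrow> nat \<Rightarrow> (('v \<Rightarrow> real vec) \<Rightarrow> real) \<Rightarrow> bool" where
  "poly_fun_le N n d g \<longleftrightarrow>
     (\<exists>(E :: ('v \<times> nat \<Rightarrow> nat) set) (c :: ('v \<times> nat \<Rightarrow> nat) \<Rightarrow> real).
        finite E \<and>
        (\<forall>e \<in> E. (\<Sum>p \<in> coords N n. e p) \<le> d) \<and>
        (\<forall>x \<in> phase_space N n.
           g x = (\<Sum>e \<in> E. c e * (\<Prod>(v, i) \<in> coords N n. (x v $ i) ^ e (v, i)))))"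

definition poly_map_le ::
    "('v, 'h, 'a, 'b) hypernet \<Rightarrow> ('v \<Rightarrow> nat) \<Rightarrow> nat \<Rightarrow> (('v \<Rightarrow> real vec) \<Rightarrow> ('v \<Rightarrow> real vec)) \<Rightarrow> bool"
  where
  "poly_map_le N n d f \<longleftrightarrow>
     (\<forall>v \<in> verts N. \<forall>i < n v. poly_fun_le N n d (\<lambda>x. f x v $ i))"

definition Syn ::
    "('v, 'h, 'a, 'b) hypernet \<Rightarrow> ('v \<Rightarrow> nat) \<Rightarrow> 'v set set \<Rightarrow> ('v \<Rightarrow> real vec) set" where
  "Syn N n P = {x \<in> phase_space N n. \<forall>B \<in> P. \<forall>v1 \<in> B. \<forall>v2 \<in> B. x v1 = x v2}"

definition invariant_under :: "'s set \<Rightarrow> ('s \<Rightarrow> 's) \<Rightarrow> bool" where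
  "invariant_under W f \<longleftrightarrow> f ` W \<subseteq> W"

definition balanced :: "('v, 'h, 'a, 'b) hypernet \<Rightarrow> 'v set set \<Rightarrow> bool" where
  "balanced N P \<longleftrightarrow>
     (\<forall>B \<in> P. \<forall>v1 \<in> B. \<forall>v2 \<in> B.
        vtype N v1 = vtype N v2 \<and>
        (\<exists>\<alpha>. type_bij N v1 v2 \<alpha> \<and>
           (\<forall>h \<in> in_edges N v1. \<forall>i < length (src N h).
              \<exists>B' \<in> P. src N h ! i \<in> B' \<and> src N (\<alpha> h) ! i \<in> B')))"

end

(* Colour the vertices by the blocks of P. The partition is balanced iff, within each block, all
   vertices receive equally many hyperedges of every type and every word of source colours.
   Summing a polynomial g of the source states over the incoming hyperedges of one type gives an
   admissible map, and its invariance on synchronous states equates the sums of g over the source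
   colour words of any two vertices of a block. It remains to isolate one word L of length m <= k
   at which the counts differ: take L with the fewest colours, give the colours of L distinct
   positive states and all others the state 0, and use a product of the m variables y_i with at
   most m(m-1)/2 linear factors y_i - z_c that kill every word other than L on the colours of L.
   The degree is at most m(m+1)/2. *)

theory Submission
  imports Defs
begin

section \<open>Matching finite sets by labels, and colouring blocks by numbers\<close>

text \<open>Fibres over the same label have equal size, so they can be matched separately, and the
  matchings glue because distinct labels have disjoint fibres. With hyperedge type and source
  colours as label, this produces the bijection that a balanced partition requires.\<close>

lemma bij_betw_of_equal_fibre_cards:
  assumes "finite A" "finite B"
    and card_eq: "\<And>l. card {a \<in> A. \<phi> a = l} = card {b \<in> B. \<psi> b = l}"
  shows "\<exists>\<alpha>. bij_betw \<alpha> A B \<and> (\<forall>a \<in> A. \<psi> (\<alpha> a) = \<phi> a)"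
proof -
  have "\<exists>\<beta>. bij_betw \<beta> {a \<in> A. \<phi> a = l} {b \<in> B. \<psi> b = l}" for l
    using assms by (intro finite_same_card_bij) auto
  then obtain \<beta> where \<beta>: "\<And>l. bij_betw (\<beta> l) {a \<in> A. \<phi> a = l} {b \<in> B. \<psi> b = l}"
    by metis
  define \<alpha> where "\<alpha> a = \<beta> (\<phi> a) a" for a
  have mem: "\<alpha> a \<in> B \<and> \<psi> (\<alpha> a) = \<phi> a" if "a \<in> A" for a
    using bij_betwE[OF \<beta>[of "\<phi> a"]] that by (auto simp: \<alpha>_def)
  have "inj_on \<alpha> A"
  proof (rule inj_onI)
    fix a a' assume a: "a \<in> A" "a' \<in> A" "\<alpha> a = \<alpha> a'"
    then have "\<phi> a = \<phi> a'" using mem by metis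
    then show "a = a'"
      using a bij_betw_imp_inj_on[OF \<beta>[of "\<phi> a"]] by (auto simp: \<alpha>_def inj_on_def)
  qed
  moreover have "B \<subseteq> \<alpha> ` A"
  proof
    fix b assume "b \<in> B"
    then have "b \<in> \<beta> (\<psi> b) ` {a \<in> A. \<phi> a = \<psi> b}"
      using bij_betw_imp_surj_on[OF \<beta>[of "\<psi> b"]] by auto
    then obtain a where "a \<in> A" "b = \<alpha> a" by (auto simp: \<alpha>_def)
    then show "b \<in> \<alpha> ` A" by blast
  qed
  ultimately have "bij_betw \<alpha> A B" using mem by (auto simp: bij_betw_def)
  with mem show ?thesis by blast
qed

text \<open>Numbering the blocks lets them serve both as letters of words and, through
  \<open>real\<close>, as pairwise distinct states.\<close>

lemma partition_on_nat_colouring: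
  assumes "finite A" "partition_on A P"
  shows "\<exists>col :: 'a \<Rightarrow> nat. \<forall>u \<in> A. \<forall>w \<in> A. col u = col w \<longleftrightarrow> (\<exists>B \<in> P. u \<in> B \<and> w \<in> B)"
proof -
  have "finite P" using assms finite_elements by blast
  then obtain f :: "'a set \<Rightarrow> nat" where f: "inj_on f P"
    using finite_imp_inj_to_nat_seg by blast
  have "\<exists>B. B \<in> P \<and> u \<in> B" if "u \<in> A" for u
    using assms(2) that by (auto simp: partition_on_def)
  then obtain blk where blk: "\<And>u. u \<in> A \<Longrightarrow> blk u \<in> P \<and> u \<in> blk u"
    by metis
  have uniq: "B = B'" if "B \<in> P" "B' \<in> P" "u \<in> B" "u \<in> B'" for u B B'
    using assms(2) that by (auto simp: partition_on_def disjoint_def)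
  have "f (blk u) = f (blk w) \<longleftrightarrow> (\<exists>B \<in> P. u \<in> B \<and> w \<in> B)" if "u \<in> A" "w \<in> A" for u w
    using blk[OF that(1)] blk[OF that(2)] inj_onD[OF f] uniq by metis
  then show ?thesis by (intro exI[of _ "\<lambda>u. f (blk u)"]) blast
qed

section \<open>Counting the linear factors that isolate a word\<close>

text \<open>Every nonempty fibre of \<open>f\<close> on \<open>D\<close> has at least two elements.
  This bounds the number of repeated letters of a word by half the number of positions they
  occupy.\<close>

lemma card_image_le_half:
  assumes "finite D" "\<And>i. i \<in> D \<Longrightarrow> \<exists>j \<in> D. j \<noteq> i \<and> f j = f i"
  shows "2 * card (f ` D) \<le> card D"
proof -
  have "2 \<le> card {i \<in> D. f i = c}" if c: "c \<in> f ` D" for c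
  proof -
    obtain i j where "i \<in> D" "j \<in> D" "j \<noteq> i" "f j = f i" "c = f i"
      using c assms(2) by blast
    then have "card {i, j} \<le> card {i \<in> D. f i = c}"
      using assms(1) by (intro card_mono) auto
    then show ?thesis using \<open>j \<noteq> i\<close> by auto
  qed
  then have "(\<Sum>c \<in> f ` D. 2) \<le> (\<Sum>c \<in> f ` D. card {i \<in> D. f i = c})"
    by (rule sum_mono)
  also have "\<dots> = card D"
    using sum.image_gen[OF assms(1), of "\<lambda>_. 1::nat" f] by simp
  finally show ?thesis by simp
qed

text \<open>The sum counts each unordered pair once, at its larger element. In the induction the new
  maximum has all the other elements below it and changes no earlier term.\<close>

lemma sum_card_below:
  fixes U :: "'a::linorder set"
  assumes "finite U"
  shows "2 * (\<Sum>i \<in> U. card {j \<in> U. j < i}) = card U * (card U - 1)"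
  using assms
proof (induction U rule: finite_linorder_max_induct)
  case empty
  then show ?case by simp
next
  case (insert b A)
  have "{j \<in> insert b A. j < b} = A" using insert by auto
  moreover have "{j \<in> insert b A. j < i} = {j \<in> A. j < i}" if "i \<in> A" for i
    using insert that by auto
  moreover have "b \<notin> A" using insert by auto
  ultimately have "2 * (\<Sum>i \<in> insert b A. card {j \<in> insert b A. j < i})
      = 2 * card A + card A * (card A - 1)"
    using insert by simp
  also have "\<dots> = card (insert b A) * (card (insert b A) - 1)"
    using insert \<open>b \<notin> A\<close> by (cases "card A") auto
  finally show ?case .
qed

text \<open>Positions carrying a repeated letter exclude every other letter; the remaining positions
  exclude only the letters of their unrepeated predecessors, which is enough because a competitor
  has to use up all letters.\<close>

lemma exclusion_sets_exist:
  fixes T :: "'c list"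
  shows "\<exists>excl. (\<forall>i < length T. excl i \<subseteq> set T - {T ! i}) \<and>
     2 * (\<Sum>i < length T. card (excl i)) \<le> length T * (length T - 1) \<and>
     (\<forall>T'. length T' = length T \<longrightarrow> set T' = set T \<longrightarrow>
        (\<forall>i < length T. T' ! i \<notin> excl i) \<longrightarrow> T' = T)"
proof -
  let ?m = "length T"
  define D where "D = {i. i < ?m \<and> (\<exists>j < ?m. j \<noteq> i \<and> T ! j = T ! i)}"
  define U where "U = {..<?m} - D"
  define excl where "excl i = (if i \<in> D then set T - {T ! i} else (!) T ` {j \<in> U. j < i})" for i
  have fin: "finite D" "finite U" by (auto simp: D_def U_def)
  have UD: "{..<?m} = U \<union> D" "U \<inter> D = {}" by (auto simp: D_def U_def)
  have single: "j = i" if "i \<in> U" "j < ?m" "T ! j = T ! i" for i j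
    using that by (auto simp: U_def D_def)
  have "excl i \<subseteq> set T - {T ! i}" if "i < ?m" for i
  proof (cases "i \<in> D")
    case True
    then show ?thesis by (auto simp: excl_def)
  next
    case False
    then have "T ! j \<noteq> T ! i" if "j \<in> U" "j < i" for j
      using single[OF that(1) \<open>i < ?m\<close>] that(2) by auto
    moreover have "U \<subseteq> {..<?m}" by (auto simp: U_def)
    ultimately show ?thesis using False by (auto simp: excl_def subset_iff)
  qed
  moreover have "2 * (\<Sum>i < ?m. card (excl i)) \<le> ?m * (?m - 1)"
  proof -
    have m: "?m = card U + card D"
      using UD fin card_Un_disjoint[of U D] by (metis card_lessThan)
    have "set T = (!) T ` (U \<union> D)"
      unfolding UD(1)[symmetric] by (auto simp: set_conv_nth)
    then have "card (set T) \<le> card ((!) T ` U) + card ((!) T ` D)"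
      by (metis card_Un_le image_Un)
    moreover have "card ((!) T ` U) \<le> card U" using fin card_image_le by blast
    moreover have "2 * card ((!) T ` D) \<le> card D"
      by (rule card_image_le_half) (auto simp: D_def, metis)
    \<comment> \<open>Each position in \<open>U\<close> supplies one letter, while a letter found in
      \<open>D\<close> occupies at least two positions there.\<close>
    ultimately have r: "2 * card (set T) \<le> 2 * card U + card D" by linarith
    have "(\<Sum>i < ?m. card (excl i)) = (\<Sum>i \<in> U. card (excl i)) + (\<Sum>i \<in> D. card (excl i))"
      unfolding UD(1) using fin UD(2) by (intro sum.union_disjoint)
    also have "(\<Sum>i \<in> D. card (excl i)) = card D * (card (set T) - 1)"
      by (simp add: excl_def D_def)
    also have "(\<Sum>i \<in> U. card (excl i)) \<le> (\<Sum>i \<in> U. card {j \<in> U. j < i})"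
      using fin by (intro sum_mono) (auto simp: excl_def U_def intro: card_image_le)
    finally have "2 * (\<Sum>i < ?m. card (excl i))
        \<le> card U * (card U - 1) + card D * (2 * (card (set T) - 1))"
      using sum_card_below[OF fin(2)] by simp
    \<comment> \<open>The target is the identity u(u-1) + d(2u+d-1) = (u+d)(u+d-1), where u and d
      are the sizes of \<open>U\<close> and \<open>D\<close>; by \<open>r\<close>, a position in
      \<open>D\<close> stays within its share of this budget.\<close>
    also have "\<dots> \<le> card U * (card U - 1) + card D * (2 * card U + card D - 1)"
      using r by (intro add_left_mono mult_left_mono) auto
    also have "\<dots> = ?m * (?m - 1)"
      unfolding m by (cases "card U"; cases "card D") (auto simp: algebra_simps)
    finally show ?thesis .
  qed
  moreover have "T' = T"
    if T': "length T' = ?m" "set T' = set T" and ex: "\<And>i. i < ?m \<Longrightarrow> T' ! i \<notin> excl i" for T'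
  proof (rule nth_equalityI)
    have onD: "T' ! i = T ! i" if "i \<in> D" for i
      using that ex[of i] T' nth_mem[of i T'] by (auto simp: excl_def D_def)
    \<comment> \<open>The letter \<open>T ! i\<close> must occur in \<open>T'\<close> at some
      position \<open>j\<close>. If \<open>j\<close> is in \<open>D\<close>, or an earlier position
      of \<open>U\<close>, then \<open>T'\<close> already agrees with \<open>T\<close> there, and
      \<open>T ! i\<close> occurs only once in \<open>T\<close>. If \<open>j\<close> is a later
      position of \<open>U\<close>, then \<open>excl j\<close> forbids this letter. Only
      \<open>j = i\<close> remains.\<close>
    have onU: "i \<in> U \<longrightarrow> T' ! i = T ! i" for i
    proof (induction i rule: less_induct)
      case (less i)
      show ?case
      proof
        assume i: "i \<in> U"
        then have "T ! i \<in> set T'" using T' by (auto simp: U_def)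
        then obtain j where j: "j < ?m" "T' ! j = T ! i"
          using T' by (metis in_set_conv_nth)
        have "j = i"
        proof (cases "j \<in> D")
          case True
          then show ?thesis using onD single[OF i j(1)] j by simp
        next
          case False
          then have jU: "j \<in> U" using j by (auto simp: U_def)
          show ?thesis
          proof (cases j i rule: linorder_cases)
            case less': less
            then show ?thesis using less.IH[OF less'] jU single[OF i j(1)] j by simp
          next
            case greater
            then have "T ! i \<in> excl j" using False i by (auto simp: excl_def)
            then show ?thesis using ex[OF j(1)] j by simp
          qed
        qed
        with j show "T' ! i = T ! i" by simp
      qed
    qed
    show "T' ! i = T ! i" if "i < length T'" for i
      using that onD onU T' by (auto simp: U_def)
  qed (use T' in auto)
  ultimately show ?thesis by blast
qed

section \<open>Synchronous states, and polynomial functions of bounded degree\<close>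

lemma SynI:
  assumes "x \<in> phase_space N n" "\<And>B u w. \<lbrakk>B \<in> P; u \<in> B; w \<in> B\<rbrakk> \<Longrightarrow> x u = x w"
  shows "x \<in> Syn N n P"
  unfolding Syn_def using assms by blast

lemma SynD: "\<lbrakk>x \<in> Syn N n P; B \<in> P; u \<in> B; w \<in> B\<rbrakk> \<Longrightarrow> x u = x w"
  unfolding Syn_def by blast

text \<open>\<open>poly_fun_le\<close> asks for a set of exponent vectors, whereas sums and products
  naturally yield indexed families in which a monomial may recur. Adding the coefficients over each
  fibre of \<open>\<epsilon>\<close> merges the repetitions.\<close>

lemma poly_fun_le_family:
  assumes "finite J" "\<And>j. j \<in> J \<Longrightarrow> (\<Sum>p \<in> coords N n. \<epsilon> j p) \<le> d"
    and g: "\<And>x. x \<in> phase_space N n \<Longrightarrow>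
          g x = (\<Sum>j \<in> J. a j * (\<Prod>(v, i) \<in> coords N n. (x v $ i) ^ \<epsilon> j (v, i)))"
  shows "poly_fun_le N n d g"
  unfolding poly_fun_le_def
proof (intro exI[of _ "\<epsilon> ` J"] exI[of _ "\<lambda>e. \<Sum>j | j \<in> J \<and> \<epsilon> j = e. a j"] conjI ballI)
  fix x assume "x \<in> phase_space N n"
  then have "g x = (\<Sum>j \<in> J. a j * (\<Prod>(v, i) \<in> coords N n. (x v $ i) ^ \<epsilon> j (v, i)))"
    by (rule g)
  also have "\<dots> = (\<Sum>e \<in> \<epsilon> ` J. \<Sum>j | j \<in> J \<and> \<epsilon> j = e.
      a j * (\<Prod>(v, i) \<in> coords N n. (x v $ i) ^ \<epsilon> j (v, i)))"
    using assms(1) by (rule sum.image_gen)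
  also have "\<dots> = (\<Sum>e \<in> \<epsilon> ` J. (\<Sum>j | j \<in> J \<and> \<epsilon> j = e. a j) *
      (\<Prod>(v, i) \<in> coords N n. (x v $ i) ^ e (v, i)))"
    by (intro sum.cong refl) (auto simp: sum_distrib_right intro: sum.cong)
  finally show "g x = \<dots>" .
qed (use assms in auto)

lemma poly_fun_le_mono: "poly_fun_le N n d g \<Longrightarrow> d \<le> d' \<Longrightarrow> poly_fun_le N n d' g"
  unfolding poly_fun_le_def by (meson order_trans)

lemma poly_fun_le_const: "poly_fun_le N n d (\<lambda>x. r)"
  by (rule poly_fun_le_family[where J = "{()}" and \<epsilon> = "\<lambda>_ _. 0" and a = "\<lambda>_. r"]) auto

lemma poly_fun_le_coord:
  assumes fin: "finite (verts N)" and mem: "(u, l) \<in> coords N n" and d: "1 \<le> d"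
  shows "poly_fun_le N n d (\<lambda>x. x u $ l)"
proof (rule poly_fun_le_family[where J = "{()}" and \<epsilon> = "\<lambda>_ p. if p = (u, l) then 1 else 0"
      and a = "\<lambda>_. 1"])
  have fin': "finite (coords N n)" using fin by (simp add: coords_def)
  show "(\<Sum>p \<in> coords N n. if p = (u, l) then 1 else 0) \<le> d"
    using fin' mem d by simp
  have "(\<Prod>(v, i) \<in> coords N n. (x v $ i) ^ (if (v, i) = (u, l) then 1 else 0))
      = (\<Prod>p \<in> coords N n. if p = (u, l) then x u $ l else 1)" for x :: "'a \<Rightarrow> real vec"
    by (intro prod.cong) (auto split: if_splits)
  then show "x u $ l = (\<Sum>j \<in> {()}. 1 *
      (\<Prod>(v, i) \<in> coords N n. (x v $ i) ^ (if (v, i) = (u, l) then 1 else 0)))"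
    for x :: "'a \<Rightarrow> real vec"
    using fin' mem by simp
qed auto

lemma poly_fun_leE:
  assumes "poly_fun_le N n d g"
  obtains E c where "finite E" "\<And>e. e \<in> E \<Longrightarrow> (\<Sum>p \<in> coords N n. e p) \<le> d"
    "\<And>x. x \<in> phase_space N n \<Longrightarrow>
      g x = (\<Sum>e \<in> E. c e * (\<Prod>(v, i) \<in> coords N n. (x v $ i) ^ e (v, i)))"
proof -
  from assms obtain E c where "finite E" "\<forall>e \<in> E. (\<Sum>p \<in> coords N n. e p) \<le> d"
    "\<forall>x \<in> phase_space N n.
      g x = (\<Sum>e \<in> E. c e * (\<Prod>(v, i) \<in> coords N n. (x v $ i) ^ e (v, i)))"
    unfolding poly_fun_le_def by (elim exE conjE)
  then show ?thesis by (intro that[of E c]) simp_all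
qed

lemma poly_fun_le_add:
  assumes "poly_fun_le N n d g" "poly_fun_le N n d g'"
  shows "poly_fun_le N n d (\<lambda>x. g x + g' x)"
proof -
  obtain E c where E: "finite E" "\<And>e. e \<in> E \<Longrightarrow> (\<Sum>p \<in> coords N n. e p) \<le> d"
      "\<And>x. x \<in> phase_space N n \<Longrightarrow>
        g x = (\<Sum>e \<in> E. c e * (\<Prod>(v, i) \<in> coords N n. (x v $ i) ^ e (v, i)))"
    using assms(1) by (rule poly_fun_leE) blast
  obtain E' c' where E': "finite E'" "\<And>e. e \<in> E' \<Longrightarrow> (\<Sum>p \<in> coords N n. e p) \<le> d"
      "\<And>x. x \<in> phase_space N n \<Longrightarrow>
        g' x = (\<Sum>e \<in> E'. c' e * (\<Prod>(v, i) \<in> coords N n. (x v $ i) ^ e (v, i)))"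
    using assms(2) by (rule poly_fun_leE) blast
  show ?thesis
    \<comment> \<open>The disjoint sum keeps the two expansions apart even when they share
      monomials.\<close>
    by (rule poly_fun_le_family[where J = "E <+> E'" and \<epsilon> = "case_sum id id"
          and a = "case_sum c c'"])
      (use E E' in \<open>auto simp: sum.Plus\<close>)
qed

lemma poly_fun_le_diff_const:
  assumes "poly_fun_le N n d g"
  shows "poly_fun_le N n d (\<lambda>x. g x - r)"
  using poly_fun_le_add[OF assms poly_fun_le_const[of N n d "- r"]] by simp

lemma poly_fun_le_sum:
  assumes "finite A" "\<And>a. a \<in> A \<Longrightarrow> poly_fun_le N n d (g a)"
  shows "poly_fun_le N n d (\<lambda>x. \<Sum>a \<in> A. g a x)"
  using assms
  by (induction A rule: finite_induct) (simp_all add: poly_fun_le_const poly_fun_le_add)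

text \<open>Expanding the product indexes its monomials by pairs, whose exponents add; different
  pairs may give the same monomial.\<close>

lemma poly_fun_le_mult:
  assumes "poly_fun_le N n d g" "poly_fun_le N n d' g'"
  shows "poly_fun_le N n (d + d') (\<lambda>x. g x * g' x)"
proof -
  obtain E c where E: "finite E" "\<And>e. e \<in> E \<Longrightarrow> (\<Sum>p \<in> coords N n. e p) \<le> d"
      "\<And>x. x \<in> phase_space N n \<Longrightarrow>
        g x = (\<Sum>e \<in> E. c e * (\<Prod>(v, i) \<in> coords N n. (x v $ i) ^ e (v, i)))"
    using assms(1) by (rule poly_fun_leE) blast
  obtain E' c' where E': "finite E'" "\<And>e. e \<in> E' \<Longrightarrow> (\<Sum>p \<in> coords N n. e p) \<le> d'"
      "\<And>x. x \<in> phase_space N n \<Longrightarrow>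
        g' x = (\<Sum>e \<in> E'. c' e * (\<Prod>(v, i) \<in> coords N n. (x v $ i) ^ e (v, i)))"
    using assms(2) by (rule poly_fun_leE) blast
  show ?thesis
  proof (rule poly_fun_le_family[where J = "E \<times> E'" and \<epsilon> = "\<lambda>(e, e') p. e p + e' p"
        and a = "\<lambda>(e, e'). c e * c' e'"])
    show "(\<Sum>p \<in> coords N n. (case j of (e, e') \<Rightarrow> \<lambda>p. e p + e' p) p) \<le> d + d'"
      if "j \<in> E \<times> E'" for j
      using that E(2) E'(2) by (auto simp: sum.distrib intro!: add_mono)
    fix x assume "x \<in> phase_space N n"
    then have "g x * g' x = (\<Sum>(e, e') \<in> E \<times> E'.
        (c e * (\<Prod>(v, i) \<in> coords N n. (x v $ i) ^ e (v, i))) *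
        (c' e' * (\<Prod>(v, i) \<in> coords N n. (x v $ i) ^ e' (v, i))))"
      by (simp only: E(3) E'(3) sum_product sum.cartesian_product)
    also have "\<dots> = (\<Sum>j \<in> E \<times> E'. (case j of (e, e') \<Rightarrow> c e * c' e') *
        (\<Prod>(v, i) \<in> coords N n. (x v $ i) ^ (case j of (e, e') \<Rightarrow> \<lambda>p. e p + e' p) (v, i)))"
      by (intro sum.cong refl) (auto simp: case_prod_beta power_add prod.distrib)
    finally show "g x * g' x = \<dots>" .
  qed (use E(1) E'(1) in auto)
qed

lemma poly_fun_le_prod:
  assumes "finite A" "\<And>a. a \<in> A \<Longrightarrow> poly_fun_le N n (d a) (g a)"
  shows "poly_fun_le N n (\<Sum>a \<in> A. d a) (\<lambda>x. \<Prod>a \<in> A. g a x)"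
  using assms
proof (induction A rule: finite_induct)
  case empty
  then show ?case by (simp add: poly_fun_le_const)
next
  case (insert a A)
  then show ?case using poly_fun_le_mult[of N n "d a" "g a"] by simp
qed

section \<open>Invariance from balance\<close>

context hypernetwork
begin

lemma finite_in_edges: "finite (in_edges N v)"
  using finite_edges by (simp add: in_edges_def)

lemma length_src_le_order: "h \<in> edges N \<Longrightarrow> length (src N h) \<le> hypernet_order N"
  unfolding hypernet_order_def using finite_edges by (intro Max_ge) auto

lemma input_in_input_space:
  assumes "x \<in> phase_space N n"
  shows "(\<lambda>h \<in> in_edges N v. map x (src N h)) \<in> input_space N n v"
proof -
  have "list_all2 (\<lambda>y u. y \<in> carrier_vec (n u)) (map x (src N h)) (src N h)"
    if "h \<in> in_edges N v" for h
    using that src_verts[of h] assms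
    by (auto simp: in_edges_def phase_space_def list_all2_conv_all_nth PiE_def Pi_def
        dest: nth_mem)
  then show ?thesis by (auto simp: input_space_def)
qed

text \<open>At a synchronous state, matched hyperedges carry equal lists of source states. Pulling
  the inputs of \<open>v2\<close> back along \<open>\<alpha>\<close> therefore gives exactly the
  inputs of \<open>v1\<close>, and the symmetry of the response functions equates the two
  values.\<close>

lemma balanced_imp_invariant:
  assumes part: "partition_on (verts N) P" and "balanced N P" and "admissible N n f"
  shows "invariant_under (Syn N n P) f"
  unfolding invariant_under_def
proof (rule image_subsetI)
  fix x assume x: "x \<in> Syn N n P"
  then have xp: "x \<in> phase_space N n" by (simp add: Syn_def)
  obtain F where F: "response_family N n F"
      and f: "\<And>v. v \<in> verts N \<Longrightarrow> f x v = F v (\<lambda>h \<in> in_edges N v. map x (src N h))"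
      and fx: "f x \<in> phase_space N n"
    using assms(3) xp by (auto simp: admissible_def)
  have "f x v1 = f x v2" if B: "B \<in> P" "v1 \<in> B" "v2 \<in> B" for B v1 v2
  proof -
    have v: "v1 \<in> verts N" "v2 \<in> verts N" using part B by (auto simp: partition_on_def)
    note bal_B = assms(2)[unfolded balanced_def, THEN bspec, THEN bspec, THEN bspec, OF B]
    have ty: "vtype N v1 = vtype N v2" using bal_B by (rule conjunct1)
    from bal_B obtain \<alpha> where \<alpha>: "type_bij N v1 v2 \<alpha>"
      and bal: "\<forall>h \<in> in_edges N v1. \<forall>i < length (src N h).
          \<exists>B' \<in> P. src N h ! i \<in> B' \<and> src N (\<alpha> h) ! i \<in> B'"
      by (elim exE conjE)
    have src_eq: "map x (src N (\<alpha> h)) = map x (src N h)" and mem: "\<alpha> h \<in> in_edges N v2"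
      if h: "h \<in> in_edges N v1" for h
    proof -
      show m: "\<alpha> h \<in> in_edges N v2" using \<alpha> h by (auto simp: type_bij_def dest: bij_betwE)
      have len: "length (src N (\<alpha> h)) = length (src N h)"
        using htype_order[of "\<alpha> h" h] \<alpha> h m by (auto simp: type_bij_def in_edges_def)
      show "map x (src N (\<alpha> h)) = map x (src N h)"
      proof (intro nth_equalityI)
        fix i assume "i < length (map x (src N (\<alpha> h)))"
        then have i: "i < length (src N h)" "i < length (src N (\<alpha> h))" using len by simp_all
        then obtain B' where B': "B' \<in> P" "src N h ! i \<in> B'" "src N (\<alpha> h) ! i \<in> B'"
          using bal h by blast
        then show "map x (src N (\<alpha> h)) ! i = map x (src N h) ! i"
          using SynD[OF x B'(1,3,2)] i by simp
      qed (simp add: len)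
    qed
    let ?X = "\<lambda>h \<in> in_edges N v2. map x (src N h)"
    have "F v2 ?X = F v1 (\<lambda>h \<in> in_edges N v1. ?X (\<alpha> h))"
      using F v ty \<alpha> input_in_input_space[OF xp] by (auto simp: response_family_def)
    also have "(\<lambda>h \<in> in_edges N v1. ?X (\<alpha> h)) = (\<lambda>h \<in> in_edges N v1. map x (src N h))"
      using src_eq mem by (intro restrict_ext) simp
    finally show ?thesis using f[OF v(1)] f[OF v(2)] by (simp only:)
  qed
  with fx show "f x \<in> Syn N n P" by (rule SynI)
qed

section \<open>Admissible test maps built from one hyperedge type\<close>

text \<open>A scalar test function suffices for phase spaces of any positive dimension: only
  coordinate 0 of each source is read, and the result fills every coordinate of the target. Fixing
  the type \<open>\<tau>\<close> makes all the lists fed to \<open>g\<close> equally long.\<close>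

definition edge_sum_map ::
    "('v \<Rightarrow> nat) \<Rightarrow> 'b \<Rightarrow> (real list \<Rightarrow> real) \<Rightarrow> ('v \<Rightarrow> real vec) \<Rightarrow> 'v \<Rightarrow> real vec" where
  "edge_sum_map n \<tau> g x = (\<lambda>v \<in> verts N. vec (n v)
     (\<lambda>_. \<Sum>h | h \<in> in_edges N v \<and> htype N h = \<tau>. g (map (\<lambda>u. x u $ 0) (src N h))))"

text \<open>A type-preserving bijection restricts to the hyperedges of type \<open>\<tau>\<close>,
  so it merely permutes the summands.\<close>

lemma admissible_edge_sum_map:
  assumes dims: "\<And>v1 v2. \<lbrakk>v1 \<in> verts N; v2 \<in> verts N; vtype N v1 = vtype N v2\<rbrakk> \<Longrightarrow> n v1 = n v2"
  shows "admissible N n (edge_sum_map n \<tau> g)"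
proof -
  define F where "F v X = vec (n v)
    (\<lambda>_. \<Sum>h | h \<in> in_edges N v \<and> htype N h = \<tau>. g (map (\<lambda>y. y $ 0) (X h)))"
    for v and X :: "'h \<Rightarrow> real vec list"
  have "F v2 X = F v1 (\<lambda>h \<in> in_edges N v1. X (\<alpha> h))"
    if v: "v1 \<in> verts N" "v2 \<in> verts N" "vtype N v1 = vtype N v2"
      and \<alpha>: "type_bij N v1 v2 \<alpha>" for v1 v2 \<alpha> X
  proof -
    have bij: "bij_betw \<alpha> {h \<in> in_edges N v1. htype N h = \<tau>} {h \<in> in_edges N v2. htype N h = \<tau>}"
    proof (rule bij_betw_imageI)
      show "inj_on \<alpha> {h \<in> in_edges N v1. htype N h = \<tau>}"
        using \<alpha> by (auto simp: type_bij_def bij_betw_def inj_on_def)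
      have "\<alpha> ` in_edges N v1 = in_edges N v2" "\<forall>h \<in> in_edges N v1. htype N (\<alpha> h) = htype N h"
        using \<alpha> by (auto simp: type_bij_def bij_betw_def)
      then show "\<alpha> ` {h \<in> in_edges N v1. htype N h = \<tau>} = {h \<in> in_edges N v2. htype N h = \<tau>}"
        by (auto simp: set_eq_iff image_iff) (metis image_eqI)+
    qed
    show ?thesis
      unfolding F_def dims[OF v]
      by (subst sum.reindex_bij_betw[OF bij, symmetric])
        (auto intro!: arg_cong[where f = "vec _"] ext sum.cong)
  qed
  then have "response_family N n F"
    unfolding response_family_def by (auto simp: F_def)
  moreover have "edge_sum_map n \<tau> g x v = F v (\<lambda>h \<in> in_edges N v. map x (src N h))"
    if "v \<in> verts N" for x v
    using that by (auto simp: edge_sum_map_def F_def o_def intro!: arg_cong[where f = "vec _"] ext sum.cong)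
  moreover have "edge_sum_map n \<tau> g \<in> phase_space N n \<rightarrow> phase_space N n"
    by (auto simp: edge_sum_map_def phase_space_def)
  ultimately show ?thesis unfolding admissible_def by blast
qed

text \<open>Position \<open>i\<close> contributes one coordinate and \<open>card (excl i)\<close>
  linear factors, degrees add over the positions, and summing over hyperedges does not raise the
  bound.\<close>

lemma poly_map_le_edge_sum_map:
  assumes pos: "\<And>v. v \<in> verts N \<Longrightarrow> n v \<ge> 1"
    and len: "\<And>h. h \<in> edges N \<Longrightarrow> htype N h = \<tau> \<Longrightarrow> length (src N h) = m"
    and g: "\<And>ys. g ys = (\<Prod>i < m. ys ! i * (\<Prod>c \<in> excl i. ys ! i - \<zeta> c))"
    and excl: "\<And>i. i < m \<Longrightarrow> finite (excl i)"
    and deg: "(\<Sum>i < m. 1 + card (excl i)) \<le> d"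
  shows "poly_map_le N n d (edge_sum_map n \<tau> g)"
proof -
  have "poly_fun_le N n d (\<lambda>x. edge_sum_map n \<tau> g x v $ j)" if v: "v \<in> verts N" "j < n v" for v j
  proof -
    have "poly_fun_le N n d (\<lambda>x. g (map (\<lambda>u. x u $ 0) (src N h)))"
      if h: "h \<in> in_edges N v" "htype N h = \<tau>" for h
    proof -
      have hm: "h \<in> edges N" "length (src N h) = m" using h len by (auto simp: in_edges_def)
      have "poly_fun_le N n (1 + card (excl i))
          (\<lambda>x. x (src N h ! i) $ 0 * (\<Prod>c \<in> excl i. x (src N h ! i) $ 0 - \<zeta> c))"
        if i: "i < m" for i
      proof -
        have "src N h ! i \<in> verts N" using src_verts[OF hm(1)] hm(2) i by auto
        then have co: "poly_fun_le N n 1 (\<lambda>x. x (src N h ! i) $ 0)"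
          using pos[of "src N h ! i"] finite_verts
          by (intro poly_fun_le_coord) (auto simp: coords_def)
        have "poly_fun_le N n (\<Sum>c \<in> excl i. 1) (\<lambda>x. \<Prod>c \<in> excl i. x (src N h ! i) $ 0 - \<zeta> c)"
          by (intro poly_fun_le_prod excl i poly_fun_le_diff_const co)
        then show ?thesis using poly_fun_le_mult[OF co] by simp
      qed
      then have "poly_fun_le N n (\<Sum>i < m. 1 + card (excl i))
          (\<lambda>x. \<Prod>i < m. x (src N h ! i) $ 0 * (\<Prod>c \<in> excl i. x (src N h ! i) $ 0 - \<zeta> c))"
        by (intro poly_fun_le_prod) auto
      then show ?thesis
        using hm(2) poly_fun_le_mono[OF _ deg] by (simp add: g)
    qed
    then have "poly_fun_le N n d (\<lambda>x. \<Sum>h | h \<in> in_edges N v \<and> htype N h = \<tau>.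
        g (map (\<lambda>u. x u $ 0) (src N h)))"
      using finite_in_edges by (intro poly_fun_le_sum) auto
    then show ?thesis using v by (simp add: edge_sum_map_def)
  qed
  then show ?thesis by (simp add: poly_map_le_def)
qed

section \<open>Equal counts of colour words from polynomial invariance\<close>

text \<open>The index set takes the words of all hyperedges of type \<open>\<tau>\<close>, not only
  of those targeting \<open>v\<close>, so that the sums at two vertices can be subtracted term by
  term.\<close>

lemma sum_over_source_colours:
  fixes col :: "'v \<Rightarrow> 'c" and G :: "'c list \<Rightarrow> real"
  shows "(\<Sum>h | h \<in> in_edges N v \<and> htype N h = \<tau>. G (map col (src N h)))
    = (\<Sum>L \<in> (\<lambda>h. map col (src N h)) ` {h \<in> edges N. htype N h = \<tau>}.
        real (card {h \<in> in_edges N v. htype N h = \<tau> \<and> map col (src N h) = L}) * G L)"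
proof -
  let ?A = "{h. h \<in> in_edges N v \<and> htype N h = \<tau>}"
  let ?\<phi> = "\<lambda>h. map col (src N h)"
  have "(\<Sum>h \<in> ?A. G (?\<phi> h))
      = (\<Sum>L \<in> ?\<phi> ` {h \<in> edges N. htype N h = \<tau>}. \<Sum>h | h \<in> ?A \<and> ?\<phi> h = L. G (?\<phi> h))"
    using finite_in_edges finite_edges
    by (intro sum.group[symmetric]) (auto simp: in_edges_def)
  also have "\<dots> = (\<Sum>L \<in> ?\<phi> ` {h \<in> edges N. htype N h = \<tau>}.
      real (card {h \<in> in_edges N v. htype N h = \<tau> \<and> ?\<phi> h = L}) * G L)"
    by (intro sum.cong refl) (simp add: conj_assoc)
  finally show ?thesis .
qed

text \<open>A discrepancy is tested at a colour word \<open>L\<close> with as few colours as possible. The state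
  vanishing on all vertices whose colour is not in \<open>L\<close>, together with the factors \<open>y\<^sub>i\<close> of the test
  polynomial, removes the words using foreign colours; minimality removes those using fewer
  colours; the exclusion sets remove the other words on the same colours.\<close>

lemma invariant_imp_equal_counts:
  fixes col :: "'v \<Rightarrow> nat"
  assumes pos: "\<And>v. v \<in> verts N \<Longrightarrow> n v \<ge> 1"
    and dims: "\<And>v1 v2. \<lbrakk>v1 \<in> verts N; v2 \<in> verts N; vtype N v1 = vtype N v2\<rbrakk> \<Longrightarrow> n v1 = n v2"
    and blocks: "\<And>B u w. \<lbrakk>B \<in> P; u \<in> B; w \<in> B\<rbrakk>
          \<Longrightarrow> u \<in> verts N \<and> vtype N u = vtype N w \<and> col u = col w"
    and inv: "\<And>f. \<lbrakk>admissible N n f;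
          poly_map_le N n (hypernet_order N * (hypernet_order N + 1) div 2) f\<rbrakk>
          \<Longrightarrow> invariant_under (Syn N n P) f"
    and B: "B \<in> P" "v1 \<in> B" "v2 \<in> B"
  shows "card {h \<in> in_edges N v1. htype N h = \<tau> \<and> map col (src N h) = L}
       = card {h \<in> in_edges N v2. htype N h = \<tau> \<and> map col (src N h) = L}"
proof -
  let ?k = "hypernet_order N"
  define cnt where
    "cnt v L = card {h \<in> in_edges N v. htype N h = \<tau> \<and> map col (src N h) = L}" for v L
  have "cnt v1 L = cnt v2 L"
  proof (induction "card (set L)" arbitrary: L rule: less_induct)
    case less
    show ?case
    proof (rule ccontr)
      assume neq: "cnt v1 L \<noteq> cnt v2 L"
      let ?m = "length L"
      \<comment> \<open>Different counts cannot both be zero, so \<open>L\<close> is realised by a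
        hyperedge of type \<open>\<tau>\<close>. Its length is then the common order of that type
        and is at most \<open>?k\<close>.\<close>
      have "{h \<in> in_edges N v1. htype N h = \<tau> \<and> map col (src N h) = L} \<noteq> {} \<or>
          {h \<in> in_edges N v2. htype N h = \<tau> \<and> map col (src N h) = L} \<noteq> {}"
        using neq unfolding cnt_def by fastforce
      then obtain h0 where h0: "h0 \<in> edges N" "htype N h0 = \<tau>" "map col (src N h0) = L"
        by (auto simp: in_edges_def)
      have len: "length (src N h) = ?m" if "h \<in> edges N" "htype N h = \<tau>" for h
        using htype_order[OF that(1) h0(1)] that h0 by auto
      have mk: "?m \<le> ?k" using length_src_le_order[OF h0(1)] h0(3) by auto
      obtain excl where excl: "\<And>i. i < ?m \<Longrightarrow> excl i \<subseteq> set L - {L ! i}"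
          and card_excl: "2 * (\<Sum>i < ?m. card (excl i)) \<le> ?m * (?m - 1)"
          and uniq: "\<And>L'. \<lbrakk>length L' = ?m; set L' = set L; \<And>i. i < ?m \<Longrightarrow> L' ! i \<notin> excl i\<rbrakk>
              \<Longrightarrow> L' = L"
        using exclusion_sets_exist[of L] by metis
      have fin_excl: "finite (excl i)" if "i < ?m" for i
        using excl[OF that] finite_subset by blast
      \<comment> \<open>The shift by 1 separates colour 0 from the value 0 reserved for foreign
        colours; on the colours of \<open>L\<close> the map is injective and positive.\<close>
      define \<zeta> where "\<zeta> c = (if c \<in> set L then real c + 1 else 0)" for c
      define g where "g ys = (\<Prod>i < ?m. ys ! i * (\<Prod>c \<in> excl i. ys ! i - \<zeta> c))" for ys
      \<comment> \<open>Working with twice the degree postpones the integer division to the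
        end.\<close>
      have "2 * (\<Sum>i < ?m. 1 + card (excl i)) \<le> 2 * ?m + ?m * (?m - 1)"
        using card_excl by (simp only: sum.distrib) simp
      also have "\<dots> = ?m * (?m + 1)" by (cases ?m) auto
      also have "\<dots> \<le> ?k * (?k + 1)" using mk by (intro mult_mono) auto
      finally have deg: "(\<Sum>i < ?m. 1 + card (excl i)) \<le> ?k * (?k + 1) div 2"
        by linarith
      let ?f = "edge_sum_map n \<tau> g"
      define x where "x = (\<lambda>v \<in> verts N. vec (n v) (\<lambda>_. \<zeta> (col v)))"
      have "x \<in> Syn N n P"
      proof (rule SynI)
        show "x \<in> phase_space N n" by (auto simp: x_def phase_space_def)
        show "x u = x w" if uw: "B' \<in> P" "u \<in> B'" "w \<in> B'" for B' u w
          using blocks[OF uw] blocks[OF uw(1,3,2)] dims[of u w] by (simp add: x_def)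
      qed
      moreover have "invariant_under (Syn N n P) ?f"
      proof (rule inv)
        show "admissible N n ?f" by (rule admissible_edge_sum_map) (fact dims)
        show "poly_map_le N n (?k * (?k + 1) div 2) ?f"
          by (rule poly_map_le_edge_sum_map[where m = ?m and excl = excl and \<zeta> = \<zeta>])
            (fact pos len g_def fin_excl deg)+
      qed
      ultimately have "?f x \<in> Syn N n P" by (auto simp: invariant_under_def)
      then have "?f x v1 $ 0 = ?f x v2 $ 0" by (simp add: SynD[OF _ B])
      moreover have "?f x v $ 0
          = (\<Sum>h | h \<in> in_edges N v \<and> htype N h = \<tau>. g (map \<zeta> (map col (src N h))))"
        if v: "v \<in> verts N" for v
      proof -
        have "map (\<lambda>u. x u $ 0) (src N h) = map \<zeta> (map col (src N h))"
          if "h \<in> in_edges N v" for h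
        proof -
          have "x u $ 0 = \<zeta> (col u)" if "u \<in> set (src N h)" for u
          proof -
            have "u \<in> verts N" using that \<open>h \<in> in_edges N v\<close> src_verts by (auto simp: in_edges_def)
            then show ?thesis using pos[of u] by (simp add: x_def)
          qed
          then show ?thesis by simp
        qed
        then have "(\<Sum>h | h \<in> in_edges N v \<and> htype N h = \<tau>. g (map (\<lambda>u. x u $ 0) (src N h)))
            = (\<Sum>h | h \<in> in_edges N v \<and> htype N h = \<tau>. g (map \<zeta> (map col (src N h))))"
          by (intro sum.cong) (auto simp del: map_map map_eq_conv)
        then show ?thesis using v pos[OF v] by (simp add: edge_sum_map_def)
      qed
      moreover have "v1 \<in> verts N" "v2 \<in> verts N" using blocks B by blast+
      ultimately have eq: "(\<Sum>h | h \<in> in_edges N v1 \<and> htype N h = \<tau>. g (map \<zeta> (map col (src N h))))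
          = (\<Sum>h | h \<in> in_edges N v2 \<and> htype N h = \<tau>. g (map \<zeta> (map col (src N h))))"
        by simp
      let ?I = "(\<lambda>h. map col (src N h)) ` {h \<in> edges N. htype N h = \<tau>}"
      have fin: "finite ?I" using finite_edges by simp
      have L_in: "L \<in> ?I" using h0 by blast
      \<comment> \<open>For words with fewer colours the induction hypothesis kills the difference
        of counts; in the other two cases a factor of \<open>g\<close> is zero.\<close>
      have vanish: "(real (cnt v1 L') - real (cnt v2 L')) * g (map \<zeta> L') = 0"
        if L': "L' \<in> ?I - {L}" for L'
      proof -
        have len': "length L' = ?m" using L' len by auto
        have zero: "g (map \<zeta> L') = 0" if "i < ?m" "\<zeta> (L' ! i) = 0 \<or> L' ! i \<in> excl i" for i
          unfolding g_def using that fin_excl[OF that(1)] len'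
          by (intro prod_zero bexI[of _ i]) auto
        consider "\<not> set L' \<subseteq> set L" | "set L' \<subset> set L" | "set L' = set L" by blast
        then show ?thesis
        proof cases
          case 1
          then obtain i where "i < ?m" "L' ! i \<notin> set L" using len' by (metis in_set_conv_nth subsetI)
          then show ?thesis using zero[of i] by (simp add: \<zeta>_def)
        next
          case 2
          then have "card (set L') < card (set L)" by (intro psubset_card_mono) auto
          then show ?thesis using less by simp
        next
          case 3
          then obtain i where "i < ?m" "L' ! i \<in> excl i" using uniq[OF len'] L' by blast
          then show ?thesis using zero[of i] by simp
        qed
      qed
      have "0 = (\<Sum>L' \<in> ?I. (real (cnt v1 L') - real (cnt v2 L')) * g (map \<zeta> L'))"
        using eq unfolding sum_over_source_colours[of "\<lambda>L'. g (map \<zeta> L')"] cnt_def[symmetric]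
        by (simp add: left_diff_distrib sum_subtractf)
      also have "\<dots> = (real (cnt v1 L) - real (cnt v2 L)) * g (map \<zeta> L)"
        by (subst sum.remove[OF fin L_in], subst sum.neutral) (use vanish in blast, simp)
      finally have "g (map \<zeta> L) = 0" using neq by simp
      \<comment> \<open>A vanishing factor would mean that a colour of \<open>L\<close> has state 0
        or shares its state with a different colour of \<open>L\<close>, both excluded by the choice
        of \<open>\<zeta>\<close>.\<close>
      then obtain i where i: "i < ?m"
          and "\<zeta> (L ! i) = 0 \<or> (\<exists>c \<in> excl i. \<zeta> (L ! i) = \<zeta> c)"
        using fin_excl by (auto simp: g_def)
      then show False using excl[OF i] by (auto simp: \<zeta>_def)
    qed
  qed
  then show ?thesis by (simp add: cnt_def)
qed

section \<open>Recovering balance from equal counts\<close>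

lemma polynomially_invariant_imp_balanced:
  assumes pos: "\<And>v. v \<in> verts N \<Longrightarrow> n v \<ge> 1"
    and dims: "\<And>v1 v2. \<lbrakk>v1 \<in> verts N; v2 \<in> verts N; vtype N v1 = vtype N v2\<rbrakk> \<Longrightarrow> n v1 = n v2"
    and refines: "refines (verts N) P (vtype_partition N)"
    and inv: "\<And>f. \<lbrakk>admissible N n f;
          poly_map_le N n (hypernet_order N * (hypernet_order N + 1) div 2) f\<rbrakk>
          \<Longrightarrow> invariant_under (Syn N n P) f"
  shows "balanced N P"
proof -
  have part: "partition_on (verts N) P" using refines by (simp add: refines_def)
  obtain col :: "'v \<Rightarrow> nat" where
    col: "\<And>u w. \<lbrakk>u \<in> verts N; w \<in> verts N\<rbrakk> \<Longrightarrow> col u = col w \<longleftrightarrow> (\<exists>B \<in> P. u \<in> B \<and> w \<in> B)"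
    using partition_on_nat_colouring[OF finite_verts part] by blast
  have in_verts: "u \<in> verts N" if "B \<in> P" "u \<in> B" for B u
    using part that by (auto simp: partition_on_def)
  have same_type: "vtype N u = vtype N w" if uw: "B \<in> P" "u \<in> B" "w \<in> B" for B u w
  proof -
    obtain Y where "Y \<in> vtype_partition N" "B \<subseteq> Y" using refines uw by (auto simp: refines_def)
    then show ?thesis using uw by (auto simp: vtype_partition_def subset_iff)
  qed
  have "\<exists>\<alpha>. type_bij N v1 v2 \<alpha> \<and> (\<forall>h \<in> in_edges N v1. \<forall>i < length (src N h).
      \<exists>B' \<in> P. src N h ! i \<in> B' \<and> src N (\<alpha> h) ! i \<in> B')"
    if B: "B \<in> P" "v1 \<in> B" "v2 \<in> B" for B v1 v2
  proof -
    \<comment> \<open>A bijection preserving this joint label respects hyperedge types and, position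
      by position, the blocks of the sources.\<close>
    let ?\<phi> = "\<lambda>h. (htype N h, map col (src N h))"
    have blocks: "u \<in> verts N \<and> vtype N u = vtype N w \<and> col u = col w"
      if "B \<in> P" "u \<in> B" "w \<in> B" for B u w
      using in_verts[OF that(1,2)] in_verts[OF that(1,3)] same_type[OF that] col that by blast
    have "card {h \<in> in_edges N v1. htype N h = \<tau> \<and> map col (src N h) = L}
        = card {h \<in> in_edges N v2. htype N h = \<tau> \<and> map col (src N h) = L}" for \<tau> L
      by (rule invariant_imp_equal_counts[where n = n and P = P and B = B])
        (fact pos dims blocks inv B)+
    then have "card {h \<in> in_edges N v1. ?\<phi> h = l} = card {h \<in> in_edges N v2. ?\<phi> h = l}" for l
      by (cases l) simp
    then obtain \<alpha> where \<alpha>: "bij_betw \<alpha> (in_edges N v1) (in_edges N v2)"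
        and lab: "\<And>h. h \<in> in_edges N v1 \<Longrightarrow> ?\<phi> (\<alpha> h) = ?\<phi> h"
      using bij_betw_of_equal_fibre_cards[OF finite_in_edges finite_in_edges, of v1 ?\<phi> v2 ?\<phi>]
      by blast
    have "\<exists>B' \<in> P. src N h ! i \<in> B' \<and> src N (\<alpha> h) ! i \<in> B'"
      if h: "h \<in> in_edges N v1" and i: "i < length (src N h)" for h i
    proof -
      have eq: "map col (src N (\<alpha> h)) = map col (src N h)" using lab[OF h] by simp
      then have i': "i < length (src N (\<alpha> h))" using i by (metis length_map)
      have "\<alpha> h \<in> edges N" "h \<in> edges N"
        using bij_betwE[OF \<alpha>] h by (auto simp: in_edges_def)
      then have "src N h ! i \<in> verts N" "src N (\<alpha> h) ! i \<in> verts N"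
        using src_verts i i' nth_mem by blast+
      moreover have "col (src N h ! i) = col (src N (\<alpha> h) ! i)"
        using eq i i' by (metis nth_map)
      ultimately show ?thesis using col by blast
    qed
    then show ?thesis using \<alpha> lab unfolding type_bij_def by blast
  qed
  then show ?thesis unfolding balanced_def by (intro ballI conjI same_type)
qed

end

theorem theorem4p1:
  fixes N :: "('v, 'h, 'a, 'b) hypernet"
    and n :: "'v \<Rightarrow> nat"
    and k :: nat
    and P :: "'v set set"
  assumes "hypernetwork N"
    and "hypernet_order N = k"
    and "\<And>v. v \<in> verts N \<Longrightarrow> n v \<ge> 1"
    and "\<And>v1 v2. \<lbrakk>v1 \<in> verts N; v2 \<in> verts N; vtype N v1 = vtype N v2\<rbrakk> \<Longrightarrow> n v1 = n v2"
    and "refines (verts N) P (vtype_partition N)"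
  shows "(balanced N P \<longleftrightarrow>
            (\<forall>f. admissible N n f \<longrightarrow> invariant_under (Syn N n P) f)) \<and>
         ((\<forall>f. admissible N n f \<longrightarrow> invariant_under (Syn N n P) f) \<longleftrightarrow>
            (\<forall>f. admissible N n f \<longrightarrow> poly_map_le N n (k * (k + 1) div 2) f \<longrightarrow>
                 invariant_under (Syn N n P) f))"
proof -
  interpret hypernetwork N by fact
  have "partition_on (verts N) P" using assms(5) by (simp add: refines_def)
  then have "invariant_under (Syn N n P) f" if "balanced N P" "admissible N n f" for f
    using balanced_imp_invariant that by blast
  moreover have "balanced N P" if "\<And>f. \<lbrakk>admissible N n f; poly_map_le N n (k * (k + 1) div 2) f\<rbrakk>
      \<Longrightarrow> invariant_under (Syn N n P) f"
    by (rule polynomially_invariant_imp_balanced[where n = n, unfolded assms(2)])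
      (fact assms(3-5) that)+
  \<comment> \<open>The implication from all admissible maps to the polynomial ones is mere
    restriction, which closes the cycle.\<close>
  ultimately show ?thesis by blast
qed

end
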